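(* Let $\mathcal{G}$ be the space of future distributions of a stationary discrete-time stochastic process $(X_t)_{t\in\mathbb{Z}}$ with values in a countable set $\mathcal{O}$, equipped with the inner product $\langle g_1,g_2\rangle=\langle\phi(g_1),\phi(g_2)\rangle_{L^2(\mu_\epsilon)}$. Then $\mathcal{G}$ is a Hilbert space if and only if the corresponding OOM is finite-dimensional, i.e. if and only if $\dim\mathcal{G}<\infty$.
   Context: Let $\mathcal{O}$ be a (nonempty) countable set and let $(X_t)_{t\in\mathbb{Z}}$ be a stationary stochastic process with values in $\mathcal{O}$, i.e. $\mathbb{P}(X_{t_1}=x_1,\dots,X_{t_k}=x_k)=\mathbb{P}(X_{t_1+l}=x_1,\dots,X_{t_k+l}=x_k)$ for all times $t_1,\dots,t_k\in\mathbb{Z}$, all $x_i\in\mathcal{O}$ and all $l\in\mathbb{Z}$. Let $\mathcal{O}^{+}=\bigcup_{i\ge 1}\mathcal{O}^i$ and $\mathcal{O}^{*}=\mathcal{O}^{+}\cup\{\epsilon\}$, where $\epsilon$ is the empty string. For $\bar a=x_1\cdots x_k\in\mathcal{O}^k$ write $\mathbb{P}(\bar a)=\mathbb{P}(X_{1}=x_1,\dots,X_{k}=x_k)$, and $\mathbb{P}(\epsilon)=1$. Concatenation of strings is written $\bar a\bar b$, and $\mathbb{P}(\bar b\mid\bar a)=\mathbb{P}(\bar a\bar b)/\mathbb{P}(\bar a)$ if $\mathbb{P}(\bar a)\neq 0$. For each $\bar a\in\mathcal{O}^{*}$ define $g_{\bar a}:\mathcal{O}^{*}\to\mathbb{R}$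 by $g_{\bar a}(\bar b)=\mathbb{P}(\bar b\mid\bar a)$ if $\mathbb{P}(\bar a)\neq 0$ (so $g_{\bar a}(\epsilon)=1$), and $g_{\bar a}\equiv 0$ if $\mathbb{P}(\bar a)=0$. The space of future distributions $\mathcal{G}$ is the real vector space of all finite linear combinations of the functions $g_{\bar a}$, $\bar a\in\mathcal{O}^{*}$. The dimension of the process (and of its observable operator model, OOM) is $\dim\mathcal{G}$. Let $F$ be the set of all right-infinite sequences of elements of $\mathcal{O}$; for $\bar b\in\mathcal{O}^k$, $k\ge1$, let $E(\bar b)\subseteq F$ be the set of sequences whose first $k$ symbols form $\bar b$. Let $\mathcal{E}=\bigcup_{k=1}^\infty\{\bigcup_{\bar b\in K}E(\bar b): K\subseteq\mathcal{O}^k\}$, an algebra of subsets of $F$, and let $\sigma(\mathcal{E})$ be the $\sigma$-algebra it generates. For $\bar a\in\mathcal{O}^{*}$, $\mu_{\bar a}$ is the unique finite measure on $\sigma(\mathcal{E})$ with $\mu_{\bar a}(\bigcup_{\bar b\in K}E(\bar b))=\sum_{\bar b\in K}g_{\bar a}(\bar b)$ for all $k\ge1$, $K\subseteq\mathcal{O}^k$. Each $\mu_{\bar a}$ has a density $\gamma(g_{\bar a})$ with respect to $\mu_\epsilon$ (the Radon–Nikodym derivative, unique up to $\mu_\epsilon$-null sets): $\mu_{\bar a}(A)=\int_A\gamma(g_{\bar a})\,d\mu_\epsilon$ for all $A\in\sigma(\mathcal{E})$, and its class $[\gamma(g_{\bar a})]$ lies in the real space $L^2(\mu_\epsilon)$.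 Fix $\Lambda\subseteq\mathcal{O}^{*}$ such that $(g_{\bar a})_{\bar a\in\Lambda}$ is a Hamel basis of $\mathcal{G}$. Then $\phi:\mathcal{G}\to L^2(\mu_\epsilon)$ is the linear map with $\phi(g_{\bar a})=[\gamma(g_{\bar a})]$ for $\bar a\in\Lambda$; it is injective and does not depend on the choice of $\Lambda$. *)

theory Defs
  imports "HOL-Probability.Probability" "HOL-Library.Function_Algebras"
begin

section \<open>Real vector spaces of functions\<close>

instantiation "fun" :: (type, real_vector) real_vector
begin

definition scaleR_fun :: "real \<Rightarrow> ('a \<Rightarrow> 'b) \<Rightarrow> 'a \<Rightarrow> 'b"
  where "scaleR_fun c f = (\<lambda>x. c *\<^sub>R f x)"

instance
  by standard (simp_all add: scaleR_fun_def fun_eq_iff scaleR_add_right scaleR_add_left)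

end

text \<open>The library's \<^const>\<open>dim\<close> is \<open>0\<close> on infinite-dimensional spaces, so
  \<open>dim V < \<infinity>\<close> is expressed by the existence of a finite basis.\<close>

definition finite_dim :: "'v::real_vector set \<Rightarrow> bool"
  where "finite_dim V \<longleftrightarrow> (\<exists>B. finite B \<and> independent B \<and> span B = V)"

definition hamel_basis_family :: "('i \<Rightarrow> 'v::real_vector) \<Rightarrow> 'i set \<Rightarrow> 'v set \<Rightarrow> bool"
  where "hamel_basis_family v I V \<longleftrightarrow>
    inj_on v I \<and> independent (v ` I) \<and> span (v ` I) = V"

section \<open>Hilbert spaces\<close>

definition inner_product_on :: "'v::real_vector set \<Rightarrow> ('v \<Rightarrow> 'v \<Rightarrow> real) \<Rightarrow> bool"
  where "inner_product_on V ip \<longleftrightarrow>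
    (\<forall>x\<in>V. \<forall>y\<in>V. ip x y = ip y x) \<and>
    (\<forall>x\<in>V. \<forall>y\<in>V. \<forall>z\<in>V. ip (x + y) z = ip x z + ip y z) \<and>
    (\<forall>c. \<forall>x\<in>V. \<forall>y\<in>V. ip (c *\<^sub>R x) y = c * ip x y) \<and>
    (\<forall>x\<in>V. 0 \<le> ip x x) \<and>
    (\<forall>x\<in>V. ip x x = 0 \<longrightarrow> x = 0)"

text \<open>The locale \<^locale>\<open>Metric_space\<close> requires symmetry and nonnegativity also off the
  carrier, hence the case distinction.\<close>

definition inner_dist :: "'v::real_vector set \<Rightarrow> ('v \<Rightarrow> 'v \<Rightarrow> real) \<Rightarrow> 'v \<Rightarrow> 'v \<Rightarrow> real"
  where "inner_dist V ip x y =
    (if x \<in> V \<and> y \<in> V then sqrt (ip (x - y) (x - y)) else 0)"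

definition hilbert_space_on :: "'v::real_vector set \<Rightarrow> ('v \<Rightarrow> 'v \<Rightarrow> real) \<Rightarrow> bool"
  where "hilbert_space_on V ip \<longleftrightarrow>
    subspace V \<and> inner_product_on V ip \<and> Metric_space.mcomplete V (inner_dist V ip)"

section \<open>The space \<open>L\<^sup>2\<close> of classes of functions modulo null sets\<close>

definition square_integrable :: "'s measure \<Rightarrow> ('s \<Rightarrow> real) set"
  where "square_integrable \<mu> = {f \<in> borel_measurable \<mu>. integrable \<mu> (\<lambda>x. (f x)\<^sup>2)}"

definition L2_class :: "'s measure \<Rightarrow> ('s \<Rightarrow> real) \<Rightarrow> ('s \<Rightarrow> real) set"
  where "L2_class \<mu> f = {h \<in> square_integrable \<mu>. AE x in \<mu>. h x = f x}"

definition L2_inner :: "'s measure \<Rightarrow> ('s \<Rightarrow> real) set \<Rightarrow> ('s \<Rightarrow> real) set \<Rightarrow> real"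
  where "L2_inner \<mu> U V = (\<integral>x. (SOME f. f \<in> U) x * (SOME h. h \<in> V) x \<partial>\<mu>)"

lemma L2_inner_class:
  assumes f: "f \<in> square_integrable \<mu>" and h: "h \<in> square_integrable \<mu>"
  shows "L2_inner \<mu> (L2_class \<mu> f) (L2_class \<mu> h) = (\<integral>x. f x * h x \<partial>\<mu>)"
proof -
  define f' where "f' = (SOME u. u \<in> L2_class \<mu> f)"
  define h' where "h' = (SOME u. u \<in> L2_class \<mu> h)"
  have "f \<in> L2_class \<mu> f" "h \<in> L2_class \<mu> h"
    using f h by (auto simp: L2_class_def)
  then have "f' \<in> L2_class \<mu> f" "h' \<in> L2_class \<mu> h"
    unfolding f'_def h'_def by (metis someI)+
  then have *: "f' \<in> borel_measurable \<mu>" "h' \<in> borel_measurable \<mu>"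
    "AE x in \<mu>. f' x = f x" "AE x in \<mu>. h' x = h x"
    by (auto simp: L2_class_def square_integrable_def)
  moreover have "f \<in> borel_measurable \<mu>" "h \<in> borel_measurable \<mu>"
    using f h by (auto simp: square_integrable_def)
  moreover have "AE x in \<mu>. f' x * h' x = f x * h x"
    using *(3,4) by eventually_elim simp
  ultimately show ?thesis
    unfolding L2_inner_def f'_def [symmetric] h'_def [symmetric]
    by (intro integral_cong_AE) auto
qed

section \<open>Stationary processes and their future distributions\<close>

definition stationary_process :: "'w measure \<Rightarrow> (int \<Rightarrow> 'w \<Rightarrow> 'o::countable) \<Rightarrow> bool"
  where "stationary_process M X \<longleftrightarrow>
    prob_space M \<and>
    (\<forall>t. X t \<in> measurable M (count_space UNIV)) \<and>
    (\<forall>ts xs l. length ts = length xs \<longrightarrow>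
       measure M {w \<in> space M. \<forall>i<length ts. X (ts ! i) w = xs ! i} =
       measure M {w \<in> space M. \<forall>i<length ts. X (ts ! i + l) w = xs ! i})"

definition word_prob :: "'w measure \<Rightarrow> (int \<Rightarrow> 'w \<Rightarrow> 'o::countable) \<Rightarrow> 'o list \<Rightarrow> real"
  where "word_prob M X a = measure M {w \<in> space M. \<forall>i<length a. X (1 + int i) w = a ! i}"

definition future_dist ::
    "'w measure \<Rightarrow> (int \<Rightarrow> 'w \<Rightarrow> 'o::countable) \<Rightarrow> 'o list \<Rightarrow> 'o list \<Rightarrow> real"
  where "future_dist M X a = (\<lambda>b.
    if word_prob M X a \<noteq> 0 then word_prob M X (a @ b) / word_prob M X a else 0)"

definition future_space :: "'w measure \<Rightarrow> (int \<Rightarrow> 'w \<Rightarrow> 'o::countable) \<Rightarrow> ('o list \<Rightarrow> real) set"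
  where "future_space M X = span (range (future_dist M X))"

section \<open>Measures on right-infinite sequences\<close>

definition cylinder :: "'o list \<Rightarrow> (nat \<Rightarrow> 'o) set"
  where "cylinder b = {s. \<forall>i<length b. s i = b ! i}"

definition cylinder_algebra :: "(nat \<Rightarrow> 'o) set set"
  where "cylinder_algebra =
    {(\<Union>b\<in>K. cylinder b) | K k. 1 \<le> k \<and> K \<subseteq> {b. length b = k}}"

definition is_sequence_measure :: "('o list \<Rightarrow> real) \<Rightarrow> (nat \<Rightarrow> 'o) measure \<Rightarrow> bool"
  where "is_sequence_measure g \<mu> \<longleftrightarrow>
    sets \<mu> = sets (sigma UNIV cylinder_algebra) \<and> finite_measure \<mu> \<and>
    (\<forall>k\<ge>1. \<forall>K \<subseteq> {b. length b = k}. (g has_sum measure \<mu> (\<Union>b\<in>K. cylinder b)) K)"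

definition sequence_measure :: "('o list \<Rightarrow> real) \<Rightarrow> (nat \<Rightarrow> 'o) measure"
  where "sequence_measure g = (THE \<mu>. is_sequence_measure g \<mu>)"

lemma mem_cylinder_iff: "s \<in> cylinder b \<longleftrightarrow> map s [0..<length b] = b"
proof -
  have "map s [0..<length b] = map ((!) b) [0..<length b] \<longleftrightarrow> s \<in> cylinder b"
    unfolding cylinder_def map_eq_conv by auto
  then show ?thesis unfolding map_nth by blast
qed

lemma UN_cylinder:
  assumes "K \<subseteq> {b. length b = k}"
  shows "(\<Union>b\<in>K. cylinder b) = {s. map s [0..<k] \<in> K}"
proof (intro equalityI subsetI)
  fix s assume "s \<in> (\<Union>b\<in>K. cylinder b)"
  then obtain b where "b \<in> K" "s \<in> cylinder b" by blast
  moreover have "length b = k" using assms \<open>b \<in> K\<close> by blast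
  ultimately show "s \<in> {s. map s [0..<k] \<in> K}" using mem_cylinder_iff[of s b] by simp
next
  fix s assume "s \<in> {s. map s [0..<k] \<in> K}"
  moreover have "s \<in> cylinder (map s [0..<k])" by (simp add: cylinder_def)
  ultimately show "s \<in> (\<Union>b\<in>K. cylinder b)" by blast
qed
lemma Int_stable_cylinder_algebra: "Int_stable (cylinder_algebra :: (nat \<Rightarrow> 'o) set set)"
proof (rule Int_stableI)
  fix A B :: "(nat \<Rightarrow> 'o) set" assume "A \<in> cylinder_algebra" "B \<in> cylinder_algebra"
  then obtain k K l L where
    A: "A = (\<Union>b\<in>K. cylinder b)" "1 \<le> k" "K \<subseteq> {b. length b = k}" and
    B: "B = (\<Union>b\<in>L. cylinder b)" "1 \<le> l" "L \<subseteq> {b. length b = l}"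
    by (auto simp: cylinder_algebra_def)
  define J where "J = {b::'o list. length b = max k l \<and> take k b \<in> K \<and> take l b \<in> L}"
  have J: "J \<subseteq> {b. length b = max k l}" by (auto simp: J_def)
  have "take k [0..<max k l] = [0..<k]" "take l [0..<max k l] = [0..<l]"
    by (simp_all add: take_upt)
  then have "map s [0..<max k l] \<in> J \<longleftrightarrow> map s [0..<k] \<in> K \<and> map s [0..<l] \<in> L" for s
    by (simp add: J_def take_map)
  then have "A \<inter> B = (\<Union>b\<in>J. cylinder b)"
    unfolding UN_cylinder[OF J] A(1) B(1) UN_cylinder[OF A(3)] UN_cylinder[OF B(3)] by blast
  moreover have "1 \<le> max k l" using A(2) by simp
  ultimately show "A \<inter> B \<in> cylinder_algebra"
    unfolding cylinder_algebra_def using J by blast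
qed

lemma sequence_measure_ex1:
  assumes "stationary_process M X"
  shows "\<exists>!\<mu>. is_sequence_measure (future_dist M X a) \<mu>"
proof (rule ex_ex1I)
  interpret prob_space M using assms by (simp add: stationary_process_def)
  have X[measurable]: "X t \<in> measurable M (count_space UNIV)" for t
    using assms by (simp add: stationary_process_def)
  define A where "A = {w \<in> space M. \<forall>i<length a. X (1 + int i) w = a ! i}"
  define p where "p = measure M A"
  have p: "word_prob M X a = p" by (simp add: word_prob_def p_def A_def)
  have A[measurable]: "A \<in> sets M" unfolding A_def by measurable
  define T where "T w i = X (1 + int (length a + i)) w" for w i
  define S where "S = sigma UNIV (cylinder_algebra :: (nat \<Rightarrow> 'b) set set)"
  have cyl: "T -` cylinder b \<inter> space M \<in> sets M" for b
  proof -
    have "T -` cylinder b \<inter> space M = {w \<in> space M. \<forall>i<length b. X (1 + int (length a + i)) w = b ! i}"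
      by (auto simp: cylinder_def T_def)
    also have "\<dots> \<in> sets M" by measurable
    finally show ?thesis .
  qed
  have T[measurable]: "T \<in> measurable M S"
    unfolding S_def
  proof (rule measurable_measure_of)
    fix B :: "(nat \<Rightarrow> 'b) set" assume "B \<in> cylinder_algebra"
    then obtain K where B: "B = (\<Union>b\<in>K. cylinder b)" by (auto simp: cylinder_algebra_def)
    have "T -` B \<inter> space M = (\<Union>b\<in>K. T -` cylinder b \<inter> space M)" by (auto simp: B)
    also have "\<dots> \<in> sets M" by (rule sets.countable_UN'') (use cyl in auto)
    finally show "T -` B \<inter> space M \<in> sets M" .
  qed auto
  define D where "D = density M (\<lambda>w. ennreal (indicator A w / p))"
  have [measurable_cong]: "sets D = sets M" by (simp add: D_def)
  have D: "emeasure D C = ennreal (measure M (A \<inter> C) / p)" if [measurable]: "C \<in> sets M" for C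
  proof -
    have "emeasure D C = (\<integral>\<^sup>+ w. ennreal (1/p) * indicator (A \<inter> C) w \<partial>M)"
      unfolding D_def
      by (subst emeasure_density) (auto intro!: nn_integral_cong simp: indicator_def)
    also have "\<dots> = ennreal (1/p) * emeasure M (A \<inter> C)"
      by (rule nn_integral_cmult_indicator) auto
    also have "\<dots> = ennreal (measure M (A \<inter> C) / p)"
      by (simp add: emeasure_eq_measure ennreal_mult[symmetric] p_def)
    finally show ?thesis .
  qed
  have finD: "finite_measure D"
    by (rule finite_measureI) (use D[OF sets.top] in \<open>simp add: D_def\<close>)
  define \<mu> where "\<mu> = distr D S T"
  have fin: "finite_measure \<mu>" unfolding \<mu>_def
    by (rule finite_measure.finite_measure_distr[OF finD]) measurable
  interpret \<mu>: finite_measure \<mu> by fact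
  have S1: "cylinder b \<in> sets S" if "1 \<le> length b" for b
  proof -
    have "cylinder b = (\<Union>c\<in>{b}. cylinder c) \<and> 1 \<le> length b \<and> {b} \<subseteq> {c. length c = length b}"
      using that by simp
    then have "cylinder b \<in> cylinder_algebra"
      unfolding cylinder_algebra_def by blast
    then show ?thesis unfolding S_def by (simp add: sigma_sets.Basic)
  qed
  have val: "measure \<mu> (cylinder b) = future_dist M X a b" if "1 \<le> length b" for b
  proof -
    have "A \<inter> (T -` cylinder b \<inter> space M) =
      {w \<in> space M. \<forall>i<length (a @ b). X (1 + int i) w = (a @ b) ! i}"
    proof -
      have "(\<forall>i<length (a @ b). X (1 + int i) w = (a @ b) ! i) \<longleftrightarrow>
        (\<forall>i<length a. X (1 + int i) w = a ! i) \<and> (\<forall>i<length b. X (1 + int (length a + i)) w = b ! i)"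
        (is "?L \<longleftrightarrow> ?R") for w
      proof
        assume L: ?L
        show ?R
        proof (intro conjI allI impI)
          fix i assume "i < length a" then show "X (1 + int i) w = a ! i"
            using L[rule_format, of i] by (simp add: nth_append)
        next
          fix i assume "i < length b" then show "X (1 + int (length a + i)) w = b ! i"
            using L[rule_format, of "length a + i"] by (simp add: nth_append)
        qed
      next
        assume R: ?R
        show ?L
        proof (intro allI impI)
          fix i assume i: "i < length (a @ b)"
          show "X (1 + int i) w = (a @ b) ! i"
            using conjunct1[OF R, rule_format, of i] conjunct2[OF R, rule_format, of "i - length a"] i
            by (cases "i < length a") (auto simp: nth_append)
        qed
      qed
      then show ?thesis by (auto simp: A_def T_def cylinder_def)
    qed
    then have "emeasure \<mu> (cylinder b) = ennreal (word_prob M X (a @ b) / p)"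
      unfolding \<mu>_def using D[OF cyl[of b]] S1[OF that]
      by (simp add: emeasure_distr word_prob_def D_def)
    then have "measure \<mu> (cylinder b) = word_prob M X (a @ b) / p"
      by (simp add: \<mu>.emeasure_eq_measure word_prob_def p_def)
    then show ?thesis
      by (simp add: future_dist_def p)
  qed
  have sum: "(future_dist M X a has_sum measure \<mu> (\<Union>b\<in>K. cylinder b)) K"
    if k: "1 \<le> k" and K: "K \<subseteq> {b. length b = k}" for k K
  proof -
    have K1: "1 \<le> length b" if "b \<in> K" for b using that k K by auto
    have disj: "disjoint_family_on cylinder K"
    proof (unfold disjoint_family_on_def, intro ballI impI)
      fix b c assume "b \<in> K" "c \<in> K" "b \<noteq> c"
      moreover have "length b = k" "length c = k" using K \<open>b \<in> K\<close> \<open>c \<in> K\<close> by blast+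
      ultimately show "cylinder b \<inter> cylinder c = {}"
        using mem_cylinder_iff[of _ b] mem_cylinder_iff[of _ c] by fastforce
    qed
    have "emeasure \<mu> (\<Union>b\<in>K. cylinder b) = (\<integral>\<^sup>+b. emeasure \<mu> (cylinder b) \<partial>count_space K)"
      by (rule emeasure_UN_countable) (use disj S1 K1 in \<open>auto simp: \<mu>_def\<close>)
    also have "\<dots> = (\<integral>\<^sup>+b. ennreal (future_dist M X a b) \<partial>count_space K)"
      by (rule nn_integral_cong) (use val K1 in \<open>auto simp: \<mu>.emeasure_eq_measure\<close>)
    finally have eq: "(\<integral>\<^sup>+b. ennreal (future_dist M X a b) \<partial>count_space K) =
      ennreal (measure \<mu> (\<Union>b\<in>K. cylinder b))" by (simp add: \<mu>.emeasure_eq_measure)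
    have nn: "0 \<le> future_dist M X a b" for b
      by (simp add: future_dist_def word_prob_def)
    have *: "Infinite_Set_Sum.abs_summable_on (future_dist M X a) K"
      unfolding abs_summable_on_def by (rule integrableI_bounded) (use eq nn in auto)
    then have "infsetsum (future_dist M X a) K = measure \<mu> (\<Union>b\<in>K. cylinder b)"
      using eq nn by (subst infsetsum_conv_nn_integral) auto
    then show ?thesis
      using * nn by (metis abs_summable_equivalent abs_summable_summable has_sum_infsum infsetsum_infsum)
  qed
  show "\<exists>\<mu>. is_sequence_measure (future_dist M X a) \<mu>"
    using sum fin by (intro exI[of _ \<mu>]) (auto simp: is_sequence_measure_def \<mu>_def S_def)
next
  fix \<mu> \<nu> :: "(nat \<Rightarrow> 'b) measure"
  assume 1: "is_sequence_measure (future_dist M X a) \<mu>"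
   and 2: "is_sequence_measure (future_dist M X a) \<nu>"
  note 1 = 1 [unfolded is_sequence_measure_def] and 2 = 2 [unfolded is_sequence_measure_def]
  interpret \<mu>: finite_measure \<mu> using 1 by simp
  interpret \<nu>: finite_measure \<nu> using 2 by simp
  have U: "UNIV \<in> (cylinder_algebra :: (nat \<Rightarrow> 'b) set set)"
  proof -
    have "UNIV = (\<Union>b\<in>{b :: 'b list. length b = 1}. cylinder b)"
      unfolding UN_cylinder[OF order_refl] by simp
    then show ?thesis unfolding cylinder_algebra_def by blast
  qed
  show "\<mu> = \<nu>"
  proof (rule measure_eqI_generator_eq[where E = cylinder_algebra and \<Omega> = UNIV and A = "\<lambda>_. UNIV"])
    fix B :: "(nat \<Rightarrow> 'b) set" assume "B \<in> cylinder_algebra"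
    then obtain k K where B: "B = (\<Union>b\<in>K. cylinder b)" "1 \<le> k" "K \<subseteq> {b. length b = k}"
      by (auto simp: cylinder_algebra_def)
    have "(future_dist M X a has_sum measure \<mu> B) K" "(future_dist M X a has_sum measure \<nu> B) K"
      using 1 2 B by simp_all
    then have "measure \<mu> B = measure \<nu> B" by (rule has_sum_unique)
    then show "emeasure \<mu> B = emeasure \<nu> B"
      by (simp add: \<mu>.emeasure_eq_measure \<nu>.emeasure_eq_measure)
  qed (use 1 2 U Int_stable_cylinder_algebra in auto)
qed

definition future_measure ::
    "'w measure \<Rightarrow> (int \<Rightarrow> 'w \<Rightarrow> 'o::countable) \<Rightarrow> 'o list \<Rightarrow> (nat \<Rightarrow> 'o) measure"
  where "future_measure M X a = sequence_measure (future_dist M X a)"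

text \<open>The density is a function of the future distribution \<open>g\<close> only, because \<open>g\<close> determines
  its measure; it is used for \<open>g = future_dist M X a\<close>, where it is the density of
  \<^term>\<open>future_measure M X a\<close>.\<close>

definition future_density ::
    "'w measure \<Rightarrow> (int \<Rightarrow> 'w \<Rightarrow> 'o::countable) \<Rightarrow> ('o list \<Rightarrow> real) \<Rightarrow> (nat \<Rightarrow> 'o) \<Rightarrow> real"
  where "future_density M X g =
    (\<lambda>s. enn2real (RN_deriv (future_measure M X []) (sequence_measure g) s))"

text \<open>\<open>construct B f\<close> is the linear map with values \<open>f\<close> on the basis \<open>B\<close>.\<close>

definition future_embedding ::
    "'w measure \<Rightarrow> (int \<Rightarrow> 'w \<Rightarrow> 'o::countable) \<Rightarrow> 'o list set \<Rightarrow>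
     ('o list \<Rightarrow> real) \<Rightarrow> ((nat \<Rightarrow> 'o) \<Rightarrow> real) set"
  where "future_embedding M X \<Lambda> h =
    L2_class (future_measure M X []) (construct (future_dist M X ` \<Lambda>) (future_density M X) h)"

definition future_inner ::
    "'w measure \<Rightarrow> (int \<Rightarrow> 'w \<Rightarrow> 'o::countable) \<Rightarrow> 'o list set \<Rightarrow>
     ('o list \<Rightarrow> real) \<Rightarrow> ('o list \<Rightarrow> real) \<Rightarrow> real"
  where "future_inner M X \<Lambda> g\<^sub>1 g\<^sub>2 =
    L2_inner (future_measure M X [])
      (future_embedding M X \<Lambda> g\<^sub>1) (future_embedding M X \<Lambda> g\<^sub>2)"

end

theory Submission
  imports Defs
begin

text \<open>
  The theorem has little to do with stochastic processes: a vector space with a \<^emph>\<open>countable\<close>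
  Hamel basis is complete for an inner product only if it is finite-dimensional. The space of future
  distributions is spanned by the functions \<open>g\<^sub>a\<close>, and there are only countably many words \<open>a\<close>
  over a countable alphabet, so each of its Hamel bases is countable.

  The completeness criterion is \<open>mcomplete_iff_finite\<close>. Gram--Schmidt turns an enumerated basis into
  an orthogonal sequence \<open>e\<^sub>0, e\<^sub>1, \<dots>\<close>. If the basis is finite, a Cauchy sequence converges
  because its finitely many Fourier coefficients do. If it is infinite, the series
  \<open>\<Sum>\<^sub>i 2\<^sup>-\<^sup>i e\<^sub>i / \<parallel>e\<^sub>i\<parallel>\<close> is Cauchy, but a limit would have infinitely many nonzero Fourier
  coefficients, whereas every vector of the space lies in the span of finitely many \<open>e\<^sub>i\<close>. This
  replaces the usual appeal to the Baire category theorem.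

  It remains to see that the form in the theorem is an inner product on the whole space of future
  distributions. By stationarity, \<open>\<mu>\<^sub>a\<close> is the law of the process after time \<open>|a|\<close>
  conditioned on the initial word \<open>a\<close>, while \<open>\<mu>\<^sub>\<epsilon>\<close> is the unconditioned law of the same
  shifted process; hence \<open>\<mu>\<^sub>a \<le> \<mu>\<^sub>\<epsilon> / P(a)\<close> (\<open>future_measure_le\<close>), and the density of
  \<open>\<mu>\<^sub>a\<close> is bounded by \<open>1 / P(a)\<close>, so it is square integrable. Integrating the linear extension
  \<open>\<Phi>\<close> of \<open>g\<^sub>a \<mapsto> d\<mu>\<^sub>a/d\<mu>\<^sub>\<epsilon>\<close> over the cylinder of a word \<open>b\<close> recovers the value at \<open>b\<close>
  (\<open>density_map_properties\<close>). So \<open>\<Phi> h = 0\<close> almost everywhere forces \<open>h = 0\<close>, which is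
  the definiteness of the form.
\<close>

section \<open>Completeness of a space with an inner product and a countable Hamel basis\<close>

locale inner_product_subspace =
  fixes V :: "'v::real_vector set" and ip :: "'v \<Rightarrow> 'v \<Rightarrow> real"
  assumes subspace: "subspace V" and inner_product: "inner_product_on V ip"
begin

lemma ip_commute: "\<lbrakk>x \<in> V; y \<in> V\<rbrakk> \<Longrightarrow> ip x y = ip y x"
  and ip_add_left: "\<lbrakk>x \<in> V; y \<in> V; z \<in> V\<rbrakk> \<Longrightarrow> ip (x + y) z = ip x z + ip y z"
  and ip_scale_left: "\<lbrakk>x \<in> V; y \<in> V\<rbrakk> \<Longrightarrow> ip (c *\<^sub>R x) y = c * ip x y"
  and ip_nonneg: "x \<in> V \<Longrightarrow> 0 \<le> ip x x"
  and ip_eq_0: "\<lbrakk>x \<in> V; ip x x = 0\<rbrakk> \<Longrightarrow> x = 0"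
  using inner_product unfolding inner_product_on_def by simp_all

lemmas mem_zero = subspace_0[OF subspace]
  and mem_add = subspace_add[OF subspace]
  and mem_diff = subspace_diff[OF subspace]
  and mem_scale = subspace_scale[OF subspace]
  and mem_sum = subspace_sum[OF subspace]

lemma ip_zero_left: "y \<in> V \<Longrightarrow> ip 0 y = 0"
  using ip_scale_left[of y y 0] by simp

lemma ip_diff_left: "\<lbrakk>x \<in> V; y \<in> V; z \<in> V\<rbrakk> \<Longrightarrow> ip (x - y) z = ip x z - ip y z"
  using ip_add_left[of "x - y" y z] mem_diff[of x y] by simp

lemma ip_sum_left:
  assumes "finite I" "\<And>i. i \<in> I \<Longrightarrow> f i \<in> V" "y \<in> V"
  shows "ip (\<Sum>i\<in>I. f i) y = (\<Sum>i\<in>I. ip (f i) y)"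
  using assms by (induction I) (auto simp: ip_zero_left ip_add_left mem_sum)

lemma ip_add_right: "\<lbrakk>x \<in> V; y \<in> V; z \<in> V\<rbrakk> \<Longrightarrow> ip x (y + z) = ip x y + ip x z"
  using ip_commute ip_add_left mem_add by metis

lemma ip_diff_right: "\<lbrakk>x \<in> V; y \<in> V; z \<in> V\<rbrakk> \<Longrightarrow> ip x (y - z) = ip x y - ip x z"
  using ip_commute ip_diff_left mem_diff by metis

lemma ip_scale_right: "\<lbrakk>x \<in> V; y \<in> V\<rbrakk> \<Longrightarrow> ip x (c *\<^sub>R y) = c * ip x y"
  using ip_commute ip_scale_left mem_scale by metis

text \<open>Nonnegativity of the form at \<open>z = \<langle>y, y\<rangle> x - \<langle>x, y\<rangle> y\<close>, a multiple of the component of \<open>x\<close>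
  orthogonal to \<open>y\<close>. Division is avoided by this scaling, and definiteness disposes of
  \<open>\<langle>y, y\<rangle> = 0\<close>.\<close>

lemma Cauchy_Schwarz:
  assumes "x \<in> V" "y \<in> V"
  shows "\<bar>ip x y\<bar> \<le> sqrt (ip x x) * sqrt (ip y y)"
proof (cases "ip y y = 0")
  case True
  then have "y = 0" using ip_eq_0 assms by blast
  then show ?thesis using ip_commute[of x 0] ip_zero_left assms mem_zero by simp
next
  case False
  then have pos: "ip y y > 0" using ip_nonneg[of y] assms by simp
  define z where "z = ip y y *\<^sub>R x - ip x y *\<^sub>R y"
  have "z \<in> V" using assms by (auto simp: z_def mem_diff mem_scale)
  have "ip z z = ip y y * (ip x x * ip y y - (ip x y)\<^sup>2)"
    using assms ip_commute[of y x]
    by (simp add: z_def ip_diff_left ip_diff_right ip_scale_left ip_scale_right mem_diff mem_scale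
        power2_eq_square algebra_simps)
  then have "(ip x y)\<^sup>2 \<le> ip x x * ip y y"
    using ip_nonneg[OF \<open>z \<in> V\<close>] pos by (simp add: zero_le_mult_iff)
  then have "sqrt ((ip x y)\<^sup>2) \<le> sqrt (ip x x * ip y y)" by (rule real_sqrt_le_mono)
  then show ?thesis by (simp add: real_sqrt_mult)
qed

lemma norm_triangle:
  assumes "x \<in> V" "y \<in> V"
  shows "sqrt (ip (x + y) (x + y)) \<le> sqrt (ip x x) + sqrt (ip y y)"
proof (rule real_le_lsqrt)
  have "ip (x + y) (x + y) = ip x x + 2 * ip x y + ip y y"
    using assms ip_commute[of y x] by (simp add: ip_add_left ip_add_right mem_add)
  also have "\<dots> \<le> ip x x + 2 * (sqrt (ip x x) * sqrt (ip y y)) + ip y y"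
    using Cauchy_Schwarz[OF assms] by simp
  also have "\<dots> = (sqrt (ip x x) + sqrt (ip y y))\<^sup>2"
    using assms ip_nonneg by (simp add: power2_sum)
  finally show "ip (x + y) (x + y) \<le> (sqrt (ip x x) + sqrt (ip y y))\<^sup>2" .
qed (use assms ip_nonneg in auto)

lemma inner_dist_eq: "\<lbrakk>x \<in> V; y \<in> V\<rbrakk> \<Longrightarrow> inner_dist V ip x y = sqrt (ip (x - y) (x - y))"
  by (simp add: inner_dist_def)

sublocale Metric_space V "inner_dist V ip"
proof
  show "0 \<le> inner_dist V ip x y" for x y
    using ip_nonneg mem_diff by (simp add: inner_dist_def)
  show "inner_dist V ip x y = inner_dist V ip y x" for x y
  proof (cases "x \<in> V \<and> y \<in> V")
    case True
    then have "ip (x - y) (x - y) = ip (y - x) (y - x)"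
      by (simp add: ip_diff_left ip_diff_right mem_diff)
    then show ?thesis by (simp add: inner_dist_def)
  qed (auto simp: inner_dist_def)
  show "inner_dist V ip x y = 0 \<longleftrightarrow> x = y" if "x \<in> V" "y \<in> V" for x y
    using that ip_eq_0[of "x - y"] mem_diff ip_zero_left[OF mem_zero] by (auto simp: inner_dist_eq)
  show "inner_dist V ip x z \<le> inner_dist V ip x y + inner_dist V ip y z"
    if "x \<in> V" "y \<in> V" "z \<in> V" for x y z
    using norm_triangle[of "x - y" "y - z"] that mem_diff by (simp add: inner_dist_eq)
qed

subsection \<open>Orthogonalisation\<close>

text \<open>The vectors are not normalised, and the input sequence may be linearly dependent: a vanishing
  \<open>gram_schmidt v i\<close> contributes nothing to later terms, because the coefficient in front of it
  is a division by \<open>0\<close> and hence \<open>0\<close>. A finite basis can therefore be padded by zeros to an infinite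
  sequence.\<close>

fun gram_schmidt :: "(nat \<Rightarrow> 'v) \<Rightarrow> nat \<Rightarrow> 'v"
  where "gram_schmidt v n = v n - (\<Sum>i<n.
    (ip (v n) (gram_schmidt v i) / ip (gram_schmidt v i) (gram_schmidt v i)) *\<^sub>R gram_schmidt v i)"

declare gram_schmidt.simps [simp del]

lemma gram_schmidt_mem: "range v \<subseteq> V \<Longrightarrow> gram_schmidt v n \<in> V"
proof (induction n rule: less_induct)
  case (less n)
  then show ?case
    by (subst gram_schmidt.simps) (auto intro!: mem_diff mem_sum mem_scale)
qed

text \<open>By induction, in the pairing of the \<open>n\<close>-th vector with an earlier one only a single term of
  the subtracted sum survives, and it cancels the pairing of \<open>v n\<close>. When the earlier vector is
  zero, both are \<open>0\<close>.\<close>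

lemma gram_schmidt_orthogonal:
  assumes "range v \<subseteq> V" "i \<noteq> j"
  shows "ip (gram_schmidt v i) (gram_schmidt v j) = 0"
proof -
  define e where "e = gram_schmidt v"
  have e: "e k \<in> V" for k unfolding e_def by (rule gram_schmidt_mem) fact
  have v: "v k \<in> V" for k using assms by auto
  have lt: "ip (e n) (e m) = 0" if "m < n" for m n
    using that
  proof (induction n arbitrary: m rule: less_induct)
    case (less n)
    have orth: "ip (e k) (e m) = 0" if "k < n" "k \<noteq> m" for k
      using that less ip_commute[OF e e, of k m] by (cases "k < m") auto
    have "ip (e n) (e m) = ip (v n) (e m) - (\<Sum>k<n. ip (v n) (e k) / ip (e k) (e k) * ip (e k) (e m))"
      unfolding e_def
      by (subst gram_schmidt.simps, fold e_def)
        (simp add: ip_diff_left ip_sum_left ip_scale_left e v mem_sum mem_scale)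
    also have "(\<Sum>k<n. ip (v n) (e k) / ip (e k) (e k) * ip (e k) (e m)) =
      (\<Sum>k<n. if k = m then ip (v n) (e m) / ip (e m) (e m) * ip (e m) (e m) else 0)"
      using orth by (intro sum.cong) auto
    also have "\<dots> = ip (v n) (e m) / ip (e m) (e m) * ip (e m) (e m)"
      using less.prems by simp
    also have "\<dots> = ip (v n) (e m)"
    proof (cases "ip (e m) (e m) = 0")
      case True
      then have "e m = 0" using ip_eq_0 e by blast
      then have "ip (v n) (e m) = 0"
        using ip_commute[OF v mem_zero] ip_zero_left[OF v] by simp
      then show ?thesis using True by simp
    qed simp
    finally show ?case by simp
  qed
  then have "ip (e i) (e j) = 0"
    using assms(2) ip_commute[OF e e, of i j] by (cases "i < j") auto
  then show ?thesis by (simp add: e_def)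
qed

text \<open>Both families are triangular in each other: the \<open>n\<close>-th vectors differ by an element of the
  common span of the previous ones.\<close>

lemma span_gram_schmidt: "span (gram_schmidt v ` {..<n}) = span (v ` {..<n})"
proof (induction n)
  case (Suc n)
  define e where "e = gram_schmidt v"
  define r where "r = (\<Sum>i<n. (ip (v n) (e i) / ip (e i) (e i)) *\<^sub>R e i)"
  have IH: "span (e ` {..<n}) = span (v ` {..<n})" using Suc by (simp add: e_def)
  have en: "e n = v n - r" unfolding e_def r_def by (subst gram_schmidt.simps) simp
  have r: "r \<in> span (e ` {..<n})"
    unfolding r_def by (intro span_sum span_scale span_base) auto
  have "span (insert (e n) (e ` {..<n})) = span (insert (v n) (v ` {..<n}))"
  proof -
    have "span (insert (e n) (e ` {..<n})) = span (insert (v n) (e ` {..<n}))"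
      by (rule eq_span_insert_eq) (use r span_neg en in \<open>force\<close>)
    also have "\<dots> = span (insert (v n) (v ` {..<n}))"
      using IH by (metis span_breakdown_eq subset_antisym subsetI)
    finally show ?thesis .
  qed
  then show ?case by (simp add: lessThan_Suc e_def)
qed simp

text \<open>The expansion is linear in \<open>x\<close>, so it suffices to check it for the spanning vectors. Some of
  these may be zero; the corresponding coefficient is then \<open>0\<close> by convention, as needed.\<close>

lemma orthogonal_expansion:
  fixes e :: "nat \<Rightarrow> 'v"
  assumes e: "\<And>i. e i \<in> V" and orth: "\<And>i j. i \<noteq> j \<Longrightarrow> ip (e i) (e j) = 0"
    and x: "x \<in> span (e ` {..<n})"
  shows "x = (\<Sum>i<n. (ip x (e i) / ip (e i) (e i)) *\<^sub>R e i)"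
proof -
  have "x \<in> {x \<in> V. x = (\<Sum>i<n. (ip x (e i) / ip (e i) (e i)) *\<^sub>R e i)}"
    using x
  proof (rule span_induct[where P = "\<lambda>x. x \<in> {x \<in> V. x = (\<Sum>i<n. (ip x (e i) / ip (e i) (e i)) *\<^sub>R e i)}"])
    fix y assume "y \<in> e ` {..<n}"
    then obtain j where j: "j < n" "y = e j" by auto
    have "(\<Sum>i<n. (ip (e j) (e i) / ip (e i) (e i)) *\<^sub>R e i) =
      (\<Sum>i<n. if i = j then (ip (e j) (e j) / ip (e j) (e j)) *\<^sub>R e j else 0)"
      by (intro sum.cong) (auto simp: orth)
    also have "\<dots> = (ip (e j) (e j) / ip (e j) (e j)) *\<^sub>R e j"
      using j(1) by (subst sum.delta) auto
    also have "\<dots> = e j"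
      using ip_eq_0[OF e, of j] by (cases "ip (e j) (e j) = 0") auto
    finally show "y \<in> {x \<in> V. x = (\<Sum>i<n. (ip x (e i) / ip (e i) (e i)) *\<^sub>R e i)}"
      using e j by simp
  next
    show "subspace {x. x \<in> {x \<in> V. x = (\<Sum>i<n. (ip x (e i) / ip (e i) (e i)) *\<^sub>R e i)}}"
    proof (intro subspaceI CollectI)
      show "0 \<in> V \<and> 0 = (\<Sum>i<n. (ip 0 (e i) / ip (e i) (e i)) *\<^sub>R e i)"
        by (simp add: mem_zero ip_zero_left e)
      fix x y c
      assume "x \<in> {x. x \<in> {x \<in> V. x = (\<Sum>i<n. (ip x (e i) / ip (e i) (e i)) *\<^sub>R e i)}}"
      then have x: "x \<in> V" "x = (\<Sum>i<n. (ip x (e i) / ip (e i) (e i)) *\<^sub>R e i)" by auto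
      have "c *\<^sub>R x = (\<Sum>i<n. (ip (c *\<^sub>R x) (e i) / ip (e i) (e i)) *\<^sub>R e i)"
        by (subst x(2)) (simp add: ip_scale_left e x(1) scaleR_sum_right)
      then show "c *\<^sub>R x \<in> V \<and> c *\<^sub>R x = (\<Sum>i<n. (ip (c *\<^sub>R x) (e i) / ip (e i) (e i)) *\<^sub>R e i)"
        using x(1) mem_scale by blast
      assume "y \<in> {x. x \<in> {x \<in> V. x = (\<Sum>i<n. (ip x (e i) / ip (e i) (e i)) *\<^sub>R e i)}}"
      then have y: "y \<in> V" "y = (\<Sum>i<n. (ip y (e i) / ip (e i) (e i)) *\<^sub>R e i)" by auto
      have "x + y = (\<Sum>i<n. (ip (x + y) (e i) / ip (e i) (e i)) *\<^sub>R e i)"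
        by (subst x(2), subst y(2))
          (simp add: ip_add_left e x(1) y(1) scaleR_add_left add_divide_distrib sum.distrib)
      then show "x + y \<in> V \<and> x + y = (\<Sum>i<n. (ip (x + y) (e i) / ip (e i) (e i)) *\<^sub>R e i)"
        using x(1) y(1) mem_add by blast
    qed
  qed
  then show ?thesis by simp
qed

text \<open>The Fourier coefficients of a Cauchy sequence are Cauchy by the Cauchy--Schwarz inequality. The
  vector with their limits as coefficients is the limit of the sequence, because the distance is at
  most a finite sum of coefficient differences, each of which tends to \<open>0\<close>.\<close>

lemma mcomplete_if_finite_span:
  assumes B: "finite B" "span B = V"
  shows mcomplete
proof -
  obtain v :: "nat \<Rightarrow> 'v" and n where v: "B = v ` {..<n}"
    using finite_imp_nat_seg_image_inj_on[OF B(1)] by (auto simp: lessThan_def)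
  define e where "e = gram_schmidt (\<lambda>i. if i < n then v i else 0)"
  have range: "range (\<lambda>i. if i < n then v i else 0) \<subseteq> V"
  proof (clarify)
    fix i
    show "(if i < n then v i else 0) \<in> V"
      using mem_zero span_base[of "v i" B] by (simp add: v flip: B(2))
  qed
  have e: "e i \<in> V" for i unfolding e_def by (rule gram_schmidt_mem[OF range])
  have orth: "ip (e i) (e j) = 0" if "i \<noteq> j" for i j
    unfolding e_def by (rule gram_schmidt_orthogonal[OF range that])
  have "V = span ((\<lambda>i. if i < n then v i else 0) ` {..<n})"
    using B(2) v by (auto intro!: arg_cong[of _ _ span] image_cong)
  then have span: "V = span (e ` {..<n})"
    unfolding e_def span_gram_schmidt .
  show ?thesis
    unfolding mcomplete_def
  proof (intro allI impI)
    fix \<sigma> assume \<sigma>: "MCauchy \<sigma>"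
    then have \<sigma>V: "\<sigma> k \<in> V" for k by (auto simp: MCauchy_def)
    have "\<exists>L. (\<lambda>k. ip (\<sigma> k) (e i)) \<longlonglongrightarrow> L" for i
    proof -
      have "Cauchy (\<lambda>k. ip (\<sigma> k) (e i))"
      proof (rule metric_CauchyI)
        fix \<epsilon> :: real assume "0 < \<epsilon>"
        define q where "q = sqrt (ip (e i) (e i)) + 1"
        have q: "q > 0" "sqrt (ip (e i) (e i)) \<le> q"
          using ip_nonneg[OF e, of i] by (auto simp: q_def add_nonneg_pos)
        obtain N where N: "\<And>m n. \<lbrakk>N \<le> m; N \<le> n\<rbrakk> \<Longrightarrow> inner_dist V ip (\<sigma> m) (\<sigma> n) < \<epsilon> / q"
          using \<sigma> \<open>0 < \<epsilon>\<close> q(1) unfolding MCauchy_def by (meson divide_pos_pos)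
        have "dist (ip (\<sigma> m) (e i)) (ip (\<sigma> n) (e i)) < \<epsilon>" if "N \<le> m" "N \<le> n" for m n
        proof -
          have "dist (ip (\<sigma> m) (e i)) (ip (\<sigma> n) (e i)) = \<bar>ip (\<sigma> m - \<sigma> n) (e i)\<bar>"
            by (simp add: dist_real_def ip_diff_left \<sigma>V e)
          also have "\<dots> \<le> inner_dist V ip (\<sigma> m) (\<sigma> n) * sqrt (ip (e i) (e i))"
            using Cauchy_Schwarz[of "\<sigma> m - \<sigma> n" "e i"] by (simp add: inner_dist_eq \<sigma>V e mem_diff)
          also have "\<dots> \<le> inner_dist V ip (\<sigma> m) (\<sigma> n) * q"
            using q by (intro mult_left_mono) auto
          also have "\<dots> < \<epsilon>" using N[OF that] q by (simp add: field_simps)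
          finally show ?thesis .
        qed
        then show "\<exists>N. \<forall>m\<ge>N. \<forall>n\<ge>N. dist (ip (\<sigma> m) (e i)) (ip (\<sigma> n) (e i)) < \<epsilon>" by blast
      qed
      then show ?thesis using Cauchy_convergent_iff convergent_def by blast
    qed
    then obtain L where L: "\<And>i. (\<lambda>k. ip (\<sigma> k) (e i)) \<longlonglongrightarrow> L i" by metis
    define y where "y = (\<Sum>i<n. (L i / ip (e i) (e i)) *\<^sub>R e i)"
    have y: "y \<in> V" unfolding y_def by (intro mem_sum mem_scale e)
    define c where "c k i = (ip (\<sigma> k) (e i) - L i) / ip (e i) (e i)" for k i
    have diff: "\<sigma> k - y = (\<Sum>i<n. c k i *\<^sub>R e i)" for k
      using orthogonal_expansion[of e "\<sigma> k" n] \<sigma>V[of k] e orth span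
      by (simp add: y_def c_def diff_divide_distrib scaleR_diff_left sum_subtractf)
    have "inner_dist V ip (\<sigma> k) y \<le> (\<Sum>i<n. \<bar>c k i\<bar> * sqrt (ip (e i) (e i)))" for k
    proof -
      have "sqrt (ip (\<Sum>i<m. c k i *\<^sub>R e i) (\<Sum>i<m. c k i *\<^sub>R e i))
          \<le> (\<Sum>i<m. \<bar>c k i\<bar> * sqrt (ip (e i) (e i)))" for m
      proof (induction m)
        case (Suc m)
        have "sqrt (ip (c k m *\<^sub>R e m) (c k m *\<^sub>R e m)) = \<bar>c k m\<bar> * sqrt (ip (e m) (e m))"
          by (simp add: ip_scale_left ip_scale_right e mem_scale real_sqrt_mult flip: mult.assoc)
        then show ?case
          using Suc norm_triangle[of "\<Sum>i<m. c k i *\<^sub>R e i" "c k m *\<^sub>R e m"]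
          by (simp add: e mem_sum mem_scale)
      qed (simp add: ip_zero_left mem_zero)
      then show ?thesis by (simp add: inner_dist_eq \<sigma>V y diff)
    qed
    moreover have "(\<lambda>k. \<Sum>i<n. \<bar>c k i\<bar> * sqrt (ip (e i) (e i))) \<longlonglongrightarrow> (\<Sum>i<n. \<bar>(L i - L i) / ip (e i) (e i)\<bar> * sqrt (ip (e i) (e i)))"
      unfolding c_def divide_inverse by (intro tendsto_intros L)
    ultimately have "(\<lambda>k. inner_dist V ip (\<sigma> k) y) \<longlonglongrightarrow> 0"
      by (intro Lim_null_comparison[of "\<lambda>k. inner_dist V ip (\<sigma> k) y"]) auto
    then show "\<exists>x. limitin mtopology \<sigma> x sequentially"
      using y \<sigma>V by (auto simp: limitin_metric_dist_null)
  qed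
qed

text \<open>The partial sums of \<open>\<Sum>\<^sub>i 2\<^sup>-\<^sup>i e\<^sub>i / \<parallel>e\<^sub>i\<parallel>\<close> form a Cauchy sequence. A limit \<open>y\<close> is a
  combination of finitely many basis vectors, so it lies in the span of \<open>e\<^sub>0, \<dots>, e\<^sub>m\<^sub>-\<^sub>1\<close> for some
  \<open>m\<close> and is orthogonal to \<open>e\<^sub>m\<close>. All later partial sums have the same nonzero component along
  \<open>e\<^sub>m\<close>, so their distance to \<open>y\<close> is at least \<open>2\<^sup>-\<^sup>m\<close>.\<close>

lemma not_mcomplete_if_infinite_countable_basis:
  assumes B: "countable B" "infinite B" "independent B" "span B = V"
  shows "\<not> mcomplete"
proof
  assume complete: mcomplete
  define v where "v = from_nat_into B"
  have v: "bij_betw v UNIV B" unfolding v_def by (rule bij_betw_from_nat_into) fact+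
  then have inj: "inj v" and B_eq: "B = range v" unfolding bij_betw_def by simp_all
  have range: "range v \<subseteq> V" using span_superset[of B] by (simp add: B(4) flip: B_eq)
  define e where "e = gram_schmidt v"
  have e: "e i \<in> V" for i unfolding e_def by (rule gram_schmidt_mem[OF range])
  have orth: "ip (e i) (e j) = 0" if "i \<noteq> j" for i j
    unfolding e_def by (rule gram_schmidt_orthogonal[OF range that])
  have span: "span (e ` {..<n}) = span (v ` {..<n})" for n
    unfolding e_def by (rule span_gram_schmidt)
  have pos: "ip (e n) (e n) > 0" for n
  proof -
    have "v n \<notin> span (v ` {..<n})"
    proof
      assume "v n \<in> span (v ` {..<n})"
      moreover have "v ` {..<n} \<subseteq> B - {v n}"
        using inj B_eq by (auto simp: inj_def)
      ultimately have "v n \<in> span (B - {v n})" using span_mono by blast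
      then show False using B(3) B_eq unfolding dependent_def by blast
    qed
    moreover have "v n \<in> span (e ` {..<n})" if "e n = 0"
    proof -
      have "v n = (\<Sum>i<n. (ip (v n) (e i) / ip (e i) (e i)) *\<^sub>R e i)"
        using that gram_schmidt.simps[of v n] by (simp add: e_def)
      moreover have "\<dots> \<in> span (e ` {..<n})"
        by (intro span_sum span_scale span_base) auto
      ultimately show ?thesis by simp
    qed
    ultimately have "e n \<noteq> 0" using span by blast
    then show ?thesis using ip_nonneg[OF e, of n] ip_eq_0[OF e, of n] by fastforce
  qed
  define c where "c i = (1/2) ^ i / sqrt (ip (e i) (e i))" for i
  define s where "s n = (\<Sum>i<n. c i *\<^sub>R e i)" for n
  have s: "s n \<in> V" for n unfolding s_def by (intro mem_sum mem_scale e)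
  have step: "inner_dist V ip (s n) (s (Suc n)) = (1/2) ^ n" for n
  proof -
    have "inner_dist V ip (s (Suc n)) (s n) = sqrt (ip (c n *\<^sub>R e n) (c n *\<^sub>R e n))"
      by (simp add: inner_dist_eq s) (simp add: s_def)
    also have "\<dots> = \<bar>c n\<bar> * sqrt (ip (e n) (e n))"
      by (simp add: ip_scale_left ip_scale_right e mem_scale real_sqrt_mult flip: mult.assoc)
    also have "\<dots> = (1/2) ^ n" using pos[of n] by (simp add: c_def)
    finally show ?thesis by (simp add: commute)
  qed
  have geometric: "inner_dist V ip (s n) (s (n + k)) \<le> 2 * (1/2) ^ n - 2 * (1/2) ^ (n + k)" for n k
  proof (induction k)
    case 0 then show ?case using s by simp
  next
    case (Suc k)
    then show ?case
      using triangle[of "s n" "s (n + k)" "s (n + Suc k)"] step[of "n + k"] s by simp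
  qed
  have "MCauchy s"
    unfolding MCauchy_def
  proof (intro conjI allI impI)
    fix \<epsilon> :: real assume "0 < \<epsilon>"
    then obtain N where N: "(1/2) ^ N < \<epsilon> / 4"
      using real_arch_pow_inv[of "\<epsilon> / 4" "1/2"] by auto
    have near: "inner_dist V ip (s N) (s n) < \<epsilon> / 2" if "N \<le> n" for n
    proof -
      have "inner_dist V ip (s N) (s n) \<le> 2 * (1/2) ^ N - 2 * (1/2) ^ n"
        using geometric[of N "n - N"] that by simp
      moreover have "(0::real) \<le> (1/2) ^ n" by simp
      ultimately show ?thesis using N by linarith
    qed
    have "inner_dist V ip (s n) (s n') < \<epsilon>" if "N \<le> n" "N \<le> n'" for n n'
      using triangle[of "s n" "s N" "s n'"] s near[of n] near[of n'] that commute[of "s n" "s N"]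
      by simp
    then show "\<exists>N. \<forall>n n'. N \<le> n \<longrightarrow> N \<le> n' \<longrightarrow> inner_dist V ip (s n) (s n') < \<epsilon>" by blast
  qed (use s in auto)
  then obtain y where "limitin mtopology s y sequentially"
    using complete unfolding mcomplete_def by blast
  then have y: "y \<in> V" and lim: "(\<lambda>n. inner_dist V ip (s n) y) \<longlonglongrightarrow> 0"
    by (auto simp: limitin_metric_dist_null)
  obtain m where m: "y \<in> span (e ` {..<m})"
  proof -
    obtain F where F: "finite F" "F \<subseteq> B" "y \<in> span F"
      using y B(4) span_explicit[of B] unfolding span_explicit by (auto intro: span_sum span_scale span_base)
    obtain I where I: "finite I" "F = v ` I"
      using F B_eq by (metis finite_subset_image)
    then obtain m where "I \<subseteq> {..<m}" using finite_nat_iff_bounded by blast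
    then have "span F \<subseteq> span (v ` {..<m})" using I by (intro span_mono) auto
    then show ?thesis using that F(3) span by blast
  qed
  have "ip y (e m) = 0"
    by (subst orthogonal_expansion[OF e orth m])
      (auto simp: ip_sum_left ip_scale_left e mem_scale orth)
  have const: "ip (s n - y) (e m) = (1/2) ^ m * sqrt (ip (e m) (e m))" if "m < n" for n
  proof -
    have "ip (s n) (e m) = (\<Sum>i<n. c i * ip (e i) (e m))"
      unfolding s_def by (simp add: ip_sum_left ip_scale_left e mem_scale)
    also have "\<dots> = (\<Sum>i<n. if i = m then c m * ip (e m) (e m) else 0)"
      by (intro sum.cong) (auto simp: orth)
    also have "\<dots> = (1/2) ^ m * sqrt (ip (e m) (e m))"
      using that pos[of m] real_div_sqrt[of "ip (e m) (e m)"] by (simp add: c_def flip: times_divide_eq_right)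
    finally show ?thesis
      using \<open>ip y (e m) = 0\<close> by (simp add: ip_diff_left s y e)
  qed
  have "(1/2) ^ m \<le> inner_dist V ip (s n) y" if "m < n" for n
  proof -
    have "(1/2) ^ m * sqrt (ip (e m) (e m)) \<le> inner_dist V ip (s n) y * sqrt (ip (e m) (e m))"
      using Cauchy_Schwarz[of "s n - y" "e m"] const[OF that]
      by (simp add: inner_dist_eq s y e mem_diff)
    then show ?thesis using pos[of m] by simp
  qed
  then have "(1/2) ^ m \<le> (0::real)"
    by (intro tendsto_lowerbound[OF lim]) (auto simp: eventually_sequentially intro!: exI[of _ "Suc m"])
  then show False using zero_less_power[of "1/2::real" m] by linarith
qed

lemma mcomplete_iff_finite:
  assumes "countable B" "independent B" "span B = V"
  shows "mcomplete \<longleftrightarrow> finite B"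
  using assms mcomplete_if_finite_span not_mcomplete_if_infinite_countable_basis by blast

end

section \<open>Future measures as conditional laws of a shifted process\<close>

abbreviation sequence_space :: "(nat \<Rightarrow> 'o) measure"
  where "sequence_space \<equiv> sigma UNIV cylinder_algebra"

lemma cylinder_in_algebra: "b \<noteq> [] \<Longrightarrow> cylinder b \<in> cylinder_algebra"
  unfolding cylinder_algebra_def
  by (rule CollectI, rule exI[of _ "{b}"], rule exI[of _ "length b"]) (simp add: Suc_leI)

lemma sets_cylinder: "cylinder b \<in> sets sequence_space"
proof (cases "b = []")
  case True
  have "UNIV \<in> sets sequence_space" using sets.top[of sequence_space] by simp
  then show ?thesis using True by (simp add: cylinder_def)
qed (simp add: cylinder_in_algebra sigma_sets.Basic)

text \<open>The cylinder algebra consists of countable disjoint unions of cylinders of equal length, and it is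
  closed under intersection, so the values on single cylinders determine the measure. The empty word
  is left out because the values of a sequence measure are prescribed only for words of positive
  length.\<close>

lemma measure_eqI_cylinder:
  fixes \<mu> \<nu> :: "(nat \<Rightarrow> 'o::countable) measure"
  assumes sets: "sets \<mu> = sets sequence_space" "sets \<nu> = sets sequence_space"
    and "finite_measure \<mu>"
    and eq: "\<And>b. b \<noteq> [] \<Longrightarrow> emeasure \<mu> (cylinder b) = emeasure \<nu> (cylinder b)"
  shows "\<mu> = \<nu>"
proof (rule measure_eqI_generator_eq[where E = cylinder_algebra and \<Omega> = UNIV and A = "\<lambda>_. UNIV"])
  interpret \<mu>: finite_measure \<mu> by fact
  show "emeasure \<mu> UNIV \<noteq> \<infinity>" by simp
  show "range (\<lambda>_. UNIV) \<subseteq> (cylinder_algebra :: (nat \<Rightarrow> 'o) set set)"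
  proof -
    have "UNIV = (\<Union>b\<in>{b :: 'o list. length b = 1}. cylinder b)"
      unfolding UN_cylinder[OF order_refl] by simp
    then show ?thesis unfolding cylinder_algebra_def by blast
  qed
  fix B :: "(nat \<Rightarrow> 'o) set" assume "B \<in> cylinder_algebra"
  then obtain k K where B: "B = (\<Union>b\<in>K. cylinder b)" "1 \<le> k" "K \<subseteq> {b. length b = k}"
    by (auto simp: cylinder_algebra_def)
  have disj: "disjoint_family_on cylinder K"
  proof (unfold disjoint_family_on_def, intro ballI impI)
    fix b c assume "b \<in> K" "c \<in> K" "b \<noteq> c"
    moreover have "length b = k" "length c = k" using B(3) \<open>b \<in> K\<close> \<open>c \<in> K\<close> by blast+
    ultimately show "cylinder b \<inter> cylinder c = {}"
      using mem_cylinder_iff[of _ b] mem_cylinder_iff[of _ c] by fastforce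
  qed
  have "emeasure \<mu> B = (\<integral>\<^sup>+b. emeasure \<mu> (cylinder b) \<partial>count_space K)"
    unfolding B(1) by (rule emeasure_UN_countable) (use disj sets sets_cylinder in auto)
  also have "\<dots> = (\<integral>\<^sup>+b. emeasure \<nu> (cylinder b) \<partial>count_space K)"
    using B(2,3) by (intro nn_integral_cong eq) auto
  also have "\<dots> = emeasure \<nu> B"
    unfolding B(1) by (rule emeasure_UN_countable[symmetric]) (use disj sets sets_cylinder in auto)
  finally show "emeasure \<mu> B = emeasure \<nu> B" .
qed (use sets Int_stable_cylinder_algebra in auto)

lemma is_sequence_measure_future_measure:
  "stationary_process M X \<Longrightarrow> is_sequence_measure (future_dist M X a) (future_measure M X a)"
  unfolding future_measure_def sequence_measure_def by (rule theI'[OF sequence_measure_ex1])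

lemma sets_future_measure:
  "stationary_process M X \<Longrightarrow> sets (future_measure M X a) = sets sequence_space"
  using is_sequence_measure_future_measure[of M X a] by (simp add: is_sequence_measure_def)

lemma finite_future_measure:
  "stationary_process M X \<Longrightarrow> finite_measure (future_measure M X a)"
  using is_sequence_measure_future_measure[of M X a] by (simp add: is_sequence_measure_def)

lemma emeasure_future_measure_cylinder:
  assumes "stationary_process M X" "b \<noteq> []"
  shows "emeasure (future_measure M X a) (cylinder b) = ennreal (future_dist M X a b)"
proof -
  have "1 \<le> length b" using assms(2) by (simp add: Suc_leI)
  then have "(future_dist M X a has_sum measure (future_measure M X a) (\<Union>c\<in>{b}. cylinder c)) {b}"
    using is_sequence_measure_future_measure[OF assms(1), of a]
    unfolding is_sequence_measure_def by blast
  then have "measure (future_measure M X a) (cylinder b) = future_dist M X a b"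
    using has_sum_finite[of "{b}" "future_dist M X a"] has_sum_unique by fastforce
  then show ?thesis
    by (simp add: finite_measure.emeasure_eq_measure finite_future_measure assms(1))
qed

definition word_event :: "'w measure \<Rightarrow> (int \<Rightarrow> 'w \<Rightarrow> 'o) \<Rightarrow> 'o list \<Rightarrow> 'w set"
  where "word_event M X a = {w \<in> space M. \<forall>i<length a. X (1 + int i) w = a ! i}"

text \<open>The process from time \<open>n + 1\<close> on, seen as a random right-infinite sequence. Words start at
  time \<open>1\<close>, so this is the future after an initial word of length \<open>n\<close>.\<close>

definition shifted_path :: "(int \<Rightarrow> 'w \<Rightarrow> 'o) \<Rightarrow> nat \<Rightarrow> 'w \<Rightarrow> nat \<Rightarrow> 'o"
  where "shifted_path X n w = (\<lambda>i. X (1 + int (n + i)) w)"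

context
  fixes M :: "'w measure" and X :: "int \<Rightarrow> 'w \<Rightarrow> 'o::countable"
  assumes stat: "stationary_process M X"
begin

interpretation prob_space M
  using stat by (simp add: stationary_process_def)

lemma measurable_process [measurable]: "X t \<in> measurable M (count_space UNIV)"
  using stat by (simp add: stationary_process_def)

lemma sets_word_event [measurable]: "word_event M X a \<in> sets M"
  unfolding word_event_def by measurable

lemma shifted_path_vimage_cylinder:
  "shifted_path X n -` cylinder b \<inter> space M =
    {w \<in> space M. \<forall>i<length b. X (1 + int (n + i)) w = b ! i}"
  by (auto simp: cylinder_def shifted_path_def)

lemma measurable_shifted_path [measurable]: "shifted_path X n \<in> measurable M sequence_space"
proof (rule measurable_measure_of)
  fix B :: "(nat \<Rightarrow> 'o) set" assume "B \<in> cylinder_algebra"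
  then obtain K where B: "B = (\<Union>b\<in>K. cylinder b)" by (auto simp: cylinder_algebra_def)
  have "shifted_path X n -` cylinder b \<inter> space M \<in> sets M" for b
    unfolding shifted_path_vimage_cylinder by measurable
  moreover have "shifted_path X n -` B \<inter> space M = (\<Union>b\<in>K. shifted_path X n -` cylinder b \<inter> space M)"
    by (auto simp: B)
  ultimately show "shifted_path X n -` B \<inter> space M \<in> sets M"
    using sets.countable_UN''[of K "\<lambda>b. shifted_path X n -` cylinder b \<inter> space M" M] by simp
qed auto

text \<open>This relates the probabilities of concatenated words, in which future distributions are expressed,
  to the random sequence that follows the first word.\<close>

lemma word_event_append:
  "word_event M X (a @ b) =
    word_event M X a \<inter> (shifted_path X (length a) -` cylinder b \<inter> space M)"
proof -
  have "(\<forall>i<length (a @ b). X (1 + int i) w = (a @ b) ! i) \<longleftrightarrow>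
    (\<forall>i<length a. X (1 + int i) w = a ! i) \<and>
    (\<forall>i<length b. X (1 + int (length a + i)) w = b ! i)" (is "?L \<longleftrightarrow> ?R \<and> ?S") for w
  proof (intro iffI conjI allI impI)
    fix i assume ?L
    show "X (1 + int i) w = a ! i" if "i < length a"
      using \<open>?L\<close>[rule_format, of i] that by (simp add: nth_append)
    show "X (1 + int (length a + i)) w = b ! i" if "i < length b"
      using \<open>?L\<close>[rule_format, of "length a + i"] that by (simp add: nth_append)
  next
    fix i assume R: "?R \<and> ?S" and i: "i < length (a @ b)"
    show "X (1 + int i) w = (a @ b) ! i"
      using conjunct1[OF R, rule_format, of i] conjunct2[OF R, rule_format, of "i - length a"] i
      by (cases "i < length a") (auto simp: nth_append)
  qed
  then show ?thesis
    unfolding shifted_path_vimage_cylinder by (auto simp: word_event_def)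
qed

text \<open>This is where stationarity enters: a shift of time does not change the law, so the law of the
  future is \<open>\<mu>\<^sub>\<epsilon>\<close> whatever the time at which the future starts.\<close>

lemma distr_shifted_path: "distr M sequence_space (shifted_path X n) = future_measure M X []"
proof (rule measure_eqI_cylinder)
  show "finite_measure (distr M sequence_space (shifted_path X n))"
    by (rule finite_measure_distr) measurable
  fix b :: "'o list" assume b: "b \<noteq> []"
  \<comment> \<open>Stationarity is used for the time tuple \<open>1, \<dots>, length b\<close>, translated by \<open>n\<close>.\<close>
  have "length (map (\<lambda>i. 1 + int i) [0..<length b]) = length b" by simp
  then have "measure M {w \<in> space M. \<forall>i<length (map (\<lambda>i. 1 + int i) [0..<length b]).
      X (map (\<lambda>i. 1 + int i) [0..<length b] ! i) w = b ! i} =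
    measure M {w \<in> space M. \<forall>i<length (map (\<lambda>i. 1 + int i) [0..<length b]).
      X (map (\<lambda>i. 1 + int i) [0..<length b] ! i + int n) w = b ! i}"
    using stat unfolding stationary_process_def by blast
  then have "measure M {w \<in> space M. \<forall>i<length b. X (1 + int (n + i)) w = b ! i} = word_prob M X b"
    by (simp add: word_prob_def algebra_simps cong: conj_cong)
  moreover have "word_prob M X [] = 1" by (simp add: word_prob_def prob_space)
  ultimately show "emeasure (distr M sequence_space (shifted_path X n)) (cylinder b) =
      emeasure (future_measure M X []) (cylinder b)"
    unfolding emeasure_distr[OF measurable_shifted_path sets_cylinder] shifted_path_vimage_cylinder
    by (simp add: algebra_simps emeasure_future_measure_cylinder stat b emeasure_eq_measure future_dist_def)
qed (simp_all add: sets_future_measure stat)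

text \<open>The conditional law of the future given \<open>a\<close> has the correct values on cylinders by
  \<open>word_event_append\<close>, hence it equals \<open>\<mu>\<^sub>a\<close>.\<close>

lemma emeasure_future_measure:
  assumes a: "word_prob M X a \<noteq> 0" and C: "C \<in> sets sequence_space"
  shows "emeasure (future_measure M X a) C =
    emeasure M (word_event M X a \<inter> (shifted_path X (length a) -` C \<inter> space M)) / ennreal (word_prob M X a)"
proof -
  define p where "p = word_prob M X a"
  have p: "p > 0" using a by (simp add: p_def word_prob_def zero_less_measure_iff)
  define D where "D = density M (\<lambda>w. indicator (word_event M X a) w / ennreal p)"
  have D: "emeasure D B = emeasure M (word_event M X a \<inter> B) / ennreal p" if "B \<in> sets M" for B
  proof -
    have "emeasure D B = (\<integral>\<^sup>+ w. indicator (word_event M X a \<inter> B) w / ennreal p \<partial>M)"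
      unfolding D_def using that
      by (subst emeasure_density) (auto intro!: nn_integral_cong simp: indicator_def)
    also have "\<dots> = emeasure M (word_event M X a \<inter> B) / ennreal p"
      using that by (subst nn_integral_divide) auto
    finally show ?thesis .
  qed
  have space_D: "space D = space M" by (simp add: D_def)
  have meas: "shifted_path X (length a) \<in> measurable D sequence_space"
    unfolding D_def by simp
  have distr: "emeasure (distr D sequence_space (shifted_path X (length a))) B =
      emeasure M (word_event M X a \<inter> (shifted_path X (length a) -` B \<inter> space M)) / ennreal p"
    if "B \<in> sets sequence_space" for B
    using that measurable_sets[OF measurable_shifted_path that, of "length a"]
    by (subst emeasure_distr[OF meas that]) (simp add: space_D D)
  have "future_measure M X a = distr D sequence_space (shifted_path X (length a))"
  proof (rule measure_eqI_cylinder)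
    fix b :: "'o list" assume "b \<noteq> []"
    have "emeasure (distr D sequence_space (shifted_path X (length a))) (cylinder b) =
      emeasure M (word_event M X (a @ b)) / ennreal p"
      unfolding word_event_append by (rule distr[OF sets_cylinder])
    also have "\<dots> = ennreal (word_prob M X (a @ b) / p)"
      using p by (simp add: emeasure_eq_measure word_prob_def word_event_def divide_ennreal)
    also have "\<dots> = ennreal (future_dist M X a b)"
      using p by (simp add: future_dist_def p_def)
    finally show "emeasure (future_measure M X a) (cylinder b) =
      emeasure (distr D sequence_space (shifted_path X (length a))) (cylinder b)"
      by (simp add: emeasure_future_measure_cylinder stat \<open>b \<noteq> []\<close>)
  qed (simp_all add: sets_future_measure finite_future_measure stat)
  then show ?thesis using distr[OF C] by (simp add: p_def)
qed

text \<open>For nonempty \<open>b\<close> this is part of the characterisation of \<open>\<mu>\<^sub>a\<close>. The value of interest is the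
  total mass, at \<open>b = []\<close>, which is known through the conditional law.\<close>

lemma future_measure_cylinder:
  assumes a: "word_prob M X a \<noteq> 0"
  shows "measure (future_measure M X a) (cylinder b) = future_dist M X a b"
proof -
  have "emeasure (future_measure M X a) (cylinder b) =
      ennreal (word_prob M X (a @ b)) / ennreal (word_prob M X a)"
    unfolding emeasure_future_measure[OF a sets_cylinder] word_event_append[symmetric]
    by (simp add: emeasure_eq_measure word_event_def word_prob_def)
  also have "\<dots> = ennreal (future_dist M X a b)"
    using a by (simp add: future_dist_def word_prob_def divide_ennreal zero_less_measure_iff)
  finally show ?thesis
    by (simp add: measure_def future_dist_def word_prob_def)
qed

text \<open>Dropping the condition that the initial word is \<open>a\<close> enlarges the event, and by stationarity its
  probability becomes that of \<open>C\<close> under \<open>\<mu>\<^sub>\<epsilon>\<close>. The inequality yields both the absolute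
  continuity of \<open>\<mu>\<^sub>a\<close> and the boundedness of its density.\<close>

lemma future_measure_le:
  assumes a: "word_prob M X a \<noteq> 0" and C: "C \<in> sets sequence_space"
  shows "emeasure (future_measure M X a) C
    \<le> ennreal (1 / word_prob M X a) * emeasure (future_measure M X []) C"
proof -
  have p: "word_prob M X a > 0" using a by (simp add: word_prob_def zero_less_measure_iff)
  have "emeasure (future_measure M X a) C
      \<le> emeasure M (shifted_path X (length a) -` C \<inter> space M) / ennreal (word_prob M X a)"
    unfolding emeasure_future_measure[OF assms]
    by (intro divide_right_mono_ennreal emeasure_mono measurable_sets[OF measurable_shifted_path C]) auto
  also have "\<dots> = ennreal (1 / word_prob M X a) * emeasure (future_measure M X []) C"
    using p C by (simp add: emeasure_distr flip: distr_shifted_path[of "length a"])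
      (simp add: emeasure_eq_measure divide_ennreal flip: ennreal_mult)
  finally show ?thesis .
qed

end

text \<open>On the set where the density exceeds \<open>c\<close> the integral of the excess is nonpositive, so the
  excess vanishes almost everywhere.\<close>

lemma AE_density_le_if_emeasure_le:
  assumes "finite_measure M" and [measurable]: "f \<in> borel_measurable M"
    and le: "\<And>C. C \<in> sets M \<Longrightarrow> emeasure (density M f) C \<le> ennreal c * emeasure M C"
  shows "AE x in M. f x \<le> ennreal c"
proof -
  interpret finite_measure M by fact
  define C where "C = {x \<in> space M. ennreal c < f x}"
  have C[measurable]: "C \<in> sets M" unfolding C_def by measurable
  have "(\<integral>\<^sup>+x. (f x - ennreal c) * indicator C x \<partial>M) =
      (\<integral>\<^sup>+x. f x * indicator C x - ennreal c * indicator C x \<partial>M)"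
    by (intro nn_integral_cong) (auto simp: indicator_def)
  also have "\<dots> = (\<integral>\<^sup>+x. f x * indicator C x \<partial>M) - (\<integral>\<^sup>+x. ennreal c * indicator C x \<partial>M)"
  proof (rule nn_integral_diff)
    show "(\<integral>\<^sup>+x. ennreal c * indicator C x \<partial>M) \<noteq> \<infinity>"
      by (simp add: nn_integral_cmult_indicator ennreal_mult_eq_top_iff)
    show "AE x in M. ennreal c * indicator C x \<le> f x * indicator C x"
      by (auto simp: C_def indicator_def)
  qed measurable
  also have "\<dots> = emeasure (density M f) C - ennreal c * emeasure M C"
    by (simp add: emeasure_density nn_integral_cmult_indicator)
  also have "\<dots> = 0" 
  proof (rule diff_eq_0_ennreal[OF _ le[OF C]])
    show "emeasure (density M f) C < top"
      using le[OF C] by (rule le_less_trans) (simp add: ennreal_mult_less_top emeasure_eq_measure)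
  qed
  finally have "AE x in M. (f x - ennreal c) * indicator C x = 0"
    by (subst (asm) nn_integral_0_iff_AE) auto
  then show ?thesis
  proof (rule AE_mp, intro AE_I2 impI)
    fix x assume x: "x \<in> space M" "(f x - ennreal c) * indicator C x = 0"
    show "f x \<le> ennreal c"
    proof (rule ccontr)
      assume "\<not> f x \<le> ennreal c"
      then show False
        using x diff_gr0_ennreal[of "ennreal c" "f x"] by (auto simp: C_def not_le)
    qed
  qed
qed

text \<open>Once the density is known to be finite almost everywhere, its passage from extended nonnegative
  to real values is harmless, and its integrals over cylinders are the values of \<open>\<mu>\<^sub>a\<close>.\<close>

lemma future_density_bounded:
  assumes stat: "stationary_process M X" and a: "word_prob M X a \<noteq> 0"
  defines "f \<equiv> future_density M X (future_dist M X a)" and "\<nu> \<equiv> future_measure M X []"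
  shows "f \<in> borel_measurable \<nu>"
    and "AE s in \<nu>. \<bar>f s\<bar> \<le> 1 / word_prob M X a"
    and "(\<integral>s. f s * indicator (cylinder b) s \<partial>\<nu>) = future_dist M X a b"
proof -
  define \<mu> where "\<mu> = future_measure M X a"
  define r where "r = RN_deriv \<nu> \<mu>"
  have f: "f = (\<lambda>s. enn2real (r s))"
    by (simp add: f_def future_density_def r_def \<nu>_def \<mu>_def future_measure_def)
  have r[measurable]: "r \<in> borel_measurable \<nu>" unfolding r_def by measurable
  show f_meas[measurable]: "f \<in> borel_measurable \<nu>" unfolding f by measurable
  interpret finite_measure \<nu> unfolding \<nu>_def by (rule finite_future_measure[OF stat])
  have sets: "sets \<mu> = sets sequence_space" "sets \<nu> = sets sequence_space"
    unfolding \<mu>_def \<nu>_def by (rule sets_future_measure[OF stat])+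
  have le: "emeasure \<mu> C \<le> ennreal (1 / word_prob M X a) * emeasure \<nu> C" if "C \<in> sets \<nu>" for C
    using future_measure_le[OF stat a, of C] that sets by (simp add: \<mu>_def \<nu>_def)
  have "absolutely_continuous \<nu> \<mu>"
    unfolding absolutely_continuous_def using le sets by (fastforce simp: null_sets_def)
  then have density: "density \<nu> r = \<mu>"
    unfolding r_def by (rule density_RN_deriv) (simp add: sets)
  have bound: "AE s in \<nu>. r s \<le> ennreal (1 / word_prob M X a)"
    by (rule AE_density_le_if_emeasure_le) (use le density finite_measure_axioms in auto)
  have p: "0 \<le> 1 / word_prob M X a" by (simp add: word_prob_def)
  show "AE s in \<nu>. \<bar>f s\<bar> \<le> 1 / word_prob M X a"
    using bound
  proof eventually_elim
    case (elim s)
    then have "enn2real (r s) \<le> 1 / word_prob M X a"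
      using enn2real_leI[OF p elim] by blast
    then show ?case by (simp add: f)
  qed
  have cyl[measurable]: "cylinder b \<in> sets \<nu>" using sets_cylinder sets by blast
  have "(\<integral>s. f s * indicator (cylinder b) s \<partial>\<nu>) =
      enn2real (\<integral>\<^sup>+s. ennreal (f s * indicator (cylinder b) s) \<partial>\<nu>)"
    by (rule integral_eq_nn_integral) (auto simp: f)
  also have "(\<integral>\<^sup>+s. ennreal (f s * indicator (cylinder b) s) \<partial>\<nu>) =
      (\<integral>\<^sup>+s. r s * indicator (cylinder b) s \<partial>\<nu>)"
  proof (rule nn_integral_cong_AE)
    show "AE s in \<nu>. ennreal (f s * indicator (cylinder b) s) = r s * indicator (cylinder b) s"
      using bound
    proof eventually_elim
      case (elim s)
      then have "r s < top" using ennreal_less_top le_less_trans by blast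
      then show ?case by (simp add: f indicator_def)
    qed
  qed
  also have "\<dots> = emeasure \<mu> (cylinder b)"
    using cyl by (simp add: emeasure_density flip: density)
  also have "enn2real \<dots> = future_dist M X a b"
    using future_measure_cylinder[OF stat a, of b] by (simp add: \<mu>_def measure_def)
  finally show "(\<integral>s. f s * indicator (cylinder b) s \<partial>\<nu>) = future_dist M X a b" .
qed

section \<open>The embedding of future distributions into bounded functions\<close>

definition density_map ::
    "'w measure \<Rightarrow> (int \<Rightarrow> 'w \<Rightarrow> 'o::countable) \<Rightarrow> 'o list set \<Rightarrow>
     ('o list \<Rightarrow> real) \<Rightarrow> (nat \<Rightarrow> 'o) \<Rightarrow> real"
  where "density_map M X \<Lambda> = construct (future_dist M X ` \<Lambda>) (future_density M X)"

context
  fixes M :: "'w measure" and X :: "int \<Rightarrow> 'w \<Rightarrow> 'o::countable" and \<Lambda> :: "'o list set"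
  assumes stat: "stationary_process M X"
    and basis: "hamel_basis_family (future_dist M X) \<Lambda> (future_space M X)"
begin

abbreviation "\<nu> \<equiv> future_measure M X []"
abbreviation "\<Phi> \<equiv> density_map M X \<Lambda>"

interpretation finite_measure \<nu>
  by (rule finite_future_measure[OF stat])

lemma independent_basis: "independent (future_dist M X ` \<Lambda>)"
  and span_basis: "span (future_dist M X ` \<Lambda>) = future_space M X"
  using basis by (simp_all add: hamel_basis_family_def)

lemma linear_density_map: "linear \<Phi>"
  unfolding density_map_def by (rule linear_construct[OF independent_basis])

lemma density_map_basis:
  "a \<in> \<Lambda> \<Longrightarrow> \<Phi> (future_dist M X a) = future_density M X (future_dist M X a)"
  unfolding density_map_def by (intro construct_basis independent_basis) auto

text \<open>For a word of probability \<open>0\<close> the future distribution is the zero function, which belongs to no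
  basis. The densities in the embedding are therefore those of conditional laws.\<close>

lemma word_prob_basis_nonzero: "a \<in> \<Lambda> \<Longrightarrow> word_prob M X a \<noteq> 0"
proof
  assume "a \<in> \<Lambda>" "word_prob M X a = 0"
  then have "(0 :: 'o list \<Rightarrow> real) \<in> future_dist M X ` \<Lambda>"
    by (intro image_eqI[of _ _ a]) (simp_all add: future_dist_def fun_eq_iff)
  then show False using dependent_zero[of "future_dist M X ` \<Lambda>"] independent_basis by simp
qed

lemma integrable_bounded_times_indicator:
  fixes f :: "(nat \<Rightarrow> 'o) \<Rightarrow> real"
  assumes [measurable]: "f \<in> borel_measurable \<nu>" and bound: "AE s in \<nu>. \<bar>f s\<bar> \<le> c"
  shows "integrable \<nu> (\<lambda>s. f s * indicator (cylinder b) s)"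
proof -
  have [measurable]: "cylinder b \<in> sets \<nu>"
    using sets_cylinder sets_future_measure[OF stat] by blast
  show ?thesis
  proof (rule integrable_const_bound)
    show "AE s in \<nu>. norm (f s * indicator (cylinder b) s) \<le> c"
      using bound by eventually_elim (auto simp: indicator_def)
  qed measurable
qed

text \<open>All three properties pass from the basis to its span. Boundedness, rather than mere square
  integrability, is carried along because it is preserved by linear combinations with no further
  inequality and makes all products integrable. For the empty word the cylinder is the
  whole space, so that the integral of \<open>\<Phi> h\<close> gives the value \<open>h []\<close>.\<close>

lemma density_map_properties:
  assumes "h \<in> future_space M X"
  shows "\<Phi> h \<in> borel_measurable \<nu> \<and> (\<exists>c. AE s in \<nu>. \<bar>\<Phi> h s\<bar> \<le> c) \<and>
    (\<forall>b. (\<integral>s. \<Phi> h s * indicator (cylinder b) s \<partial>\<nu>) = h b)" (is "?P h")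
  using assms unfolding span_basis[symmetric]
proof (rule span_induct[where P = ?P])
  fix h assume "h \<in> future_dist M X ` \<Lambda>"
  then obtain a where a: "a \<in> \<Lambda>" "h = future_dist M X a" by blast
  then show "?P h"
    using future_density_bounded[OF stat word_prob_basis_nonzero, of a]
    unfolding a(2) density_map_basis[OF a(1)] by blast
next
  show "subspace {h. ?P h}"
  proof (intro subspaceI CollectI)
    have zero: "\<Phi> 0 = (\<lambda>s. 0)"
      unfolding linear_0[OF linear_density_map] by (simp add: zero_fun_def)
    show "?P 0"
      unfolding zero by auto
  next
    fix h k assume "h \<in> {h. ?P h}" "k \<in> {h. ?P h}"
    then obtain c d where
      [measurable]: "\<Phi> h \<in> borel_measurable \<nu>" "\<Phi> k \<in> borel_measurable \<nu>" and
      bound: "AE s in \<nu>. \<bar>\<Phi> h s\<bar> \<le> c" "AE s in \<nu>. \<bar>\<Phi> k s\<bar> \<le> d" and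
      int: "\<And>b. (\<integral>s. \<Phi> h s * indicator (cylinder b) s \<partial>\<nu>) = h b"
        "\<And>b. (\<integral>s. \<Phi> k s * indicator (cylinder b) s \<partial>\<nu>) = k b" by blast
    have add: "\<Phi> (h + k) = (\<lambda>s. \<Phi> h s + \<Phi> k s)"
      unfolding linear_add[OF linear_density_map] by (simp add: plus_fun_def)
    have "AE s in \<nu>. \<bar>\<Phi> h s + \<Phi> k s\<bar> \<le> c + d"
      using bound by eventually_elim linarith
    moreover have "(\<integral>s. (\<Phi> h s + \<Phi> k s) * indicator (cylinder b) s \<partial>\<nu>) = (h + k) b" for b
      unfolding distrib_right
      using integrable_bounded_times_indicator[OF _ bound(1), of b]
        integrable_bounded_times_indicator[OF _ bound(2), of b] int
      by (subst Bochner_Integration.integral_add) (auto simp: plus_fun_def)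
    ultimately show "?P (h + k)" unfolding add by (auto intro!: borel_measurable_add)
  next
    fix r h assume "h \<in> {h. ?P h}"
    then obtain c where
      [measurable]: "\<Phi> h \<in> borel_measurable \<nu>" and bound: "AE s in \<nu>. \<bar>\<Phi> h s\<bar> \<le> c" and
      int: "\<And>b. (\<integral>s. \<Phi> h s * indicator (cylinder b) s \<partial>\<nu>) = h b" by blast
    have scale: "\<Phi> (r *\<^sub>R h) = (\<lambda>s. r * \<Phi> h s)"
      unfolding linear_scale[OF linear_density_map] by (simp add: scaleR_fun_def)
    have "AE s in \<nu>. \<bar>r * \<Phi> h s\<bar> \<le> \<bar>r\<bar> * c"
      using bound by eventually_elim (simp add: abs_mult mult_left_mono)
    moreover have "(\<integral>s. (r * \<Phi> h s) * indicator (cylinder b) s \<partial>\<nu>) = (r *\<^sub>R h) b" for b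
      using int[of b] by (simp add: mult.assoc scaleR_fun_def)
    ultimately show "?P (r *\<^sub>R h)" unfolding scale by (auto intro!: borel_measurable_times)
  qed
qed

lemma density_map_measurable [measurable]:
  "h \<in> future_space M X \<Longrightarrow> \<Phi> h \<in> borel_measurable \<nu>"
  using density_map_properties by blast

lemma density_map_integrable_mult:
  assumes "g \<in> future_space M X" "h \<in> future_space M X"
  shows "integrable \<nu> (\<lambda>s. \<Phi> g s * \<Phi> h s)"
proof -
  obtain c d where bound: "AE s in \<nu>. \<bar>\<Phi> g s\<bar> \<le> c" "AE s in \<nu>. \<bar>\<Phi> h s\<bar> \<le> d"
    using density_map_properties assms by blast
  have "AE s in \<nu>. norm (\<Phi> g s * \<Phi> h s) \<le> c * d"
    using bound
  proof eventually_elim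
    case (elim s)
    then show ?case using mult_mono[OF elim] by (simp add: abs_mult)
  qed
  then show ?thesis
    using assms by (intro integrable_const_bound) (auto intro!: borel_measurable_times density_map_measurable)
qed

lemma density_map_square_integrable:
  "h \<in> future_space M X \<Longrightarrow> \<Phi> h \<in> square_integrable \<nu>"
  using density_map_integrable_mult[of h h] density_map_measurable
  by (simp add: square_integrable_def power2_eq_square)

lemma density_map_injective:
  assumes h: "h \<in> future_space M X" and zero: "AE s in \<nu>. \<Phi> h s = 0"
  shows "h = 0"
proof
  fix b
  have "h b = (\<integral>s. \<Phi> h s * indicator (cylinder b) s \<partial>\<nu>)"
    using density_map_properties[OF h] by simp
  also have "\<dots> = 0"
    by (rule integral_eq_zero_AE) (use zero in \<open>eventually_elim, simp\<close>)
  finally show "h b = 0 b" by simp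
qed

lemma future_inner_eq:
  "\<lbrakk>g \<in> future_space M X; h \<in> future_space M X\<rbrakk> \<Longrightarrow>
    future_inner M X \<Lambda> g h = (\<integral>s. \<Phi> g s * \<Phi> h s \<partial>\<nu>)"
  unfolding future_inner_def future_embedding_def density_map_def[symmetric]
  by (intro L2_inner_class density_map_square_integrable)

lemma subspace_future_space: "subspace (future_space M X)"
  by (simp add: future_space_def)

text \<open>Symmetry, linearity and nonnegativity are those of the integral of a product; definiteness is the
  injectivity of the embedding.\<close>

lemma inner_product_future_inner:
  "inner_product_on (future_space M X) (future_inner M X \<Lambda>)"
  unfolding inner_product_on_def
proof (intro conjI ballI allI impI)
  fix g h k assume g: "g \<in> future_space M X" and h: "h \<in> future_space M X" and k: "k \<in> future_space M X"
  have "\<Phi> (g + h) = (\<lambda>s. \<Phi> g s + \<Phi> h s)"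
    unfolding linear_add[OF linear_density_map] by (simp add: plus_fun_def)
  then show "future_inner M X \<Lambda> (g + h) k = future_inner M X \<Lambda> g k + future_inner M X \<Lambda> h k"
    using g h k subspace_add[OF subspace_future_space g h]
    by (simp add: future_inner_eq distrib_right density_map_integrable_mult)
next
  fix c g h assume g: "g \<in> future_space M X" and h: "h \<in> future_space M X"
  have "\<Phi> (c *\<^sub>R g) = (\<lambda>s. c * \<Phi> g s)"
    unfolding linear_scale[OF linear_density_map] by (simp add: scaleR_fun_def)
  then show "future_inner M X \<Lambda> (c *\<^sub>R g) h = c * future_inner M X \<Lambda> g h"
    using g h subspace_scale[OF subspace_future_space g, of c]
    by (simp add: future_inner_eq mult.assoc)
next
  fix g assume g: "g \<in> future_space M X" and "future_inner M X \<Lambda> g g = 0"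
  then have "AE s in \<nu>. \<Phi> g s * \<Phi> g s = 0"
    using integral_nonneg_eq_0_iff_AE[OF density_map_integrable_mult[OF g g]]
    by (simp add: future_inner_eq)
  then show "g = 0" by (intro density_map_injective g) simp
qed (simp_all add: future_inner_eq mult.commute)

end

section \<open>Completeness of the space of future distributions\<close>

theorem corollary5p5:
  fixes M :: "'w measure" and X :: "int \<Rightarrow> 'w \<Rightarrow> 'o::countable" and \<Lambda> :: "'o list set"
  assumes "stationary_process M X"
    and "hamel_basis_family (future_dist M X) \<Lambda> (future_space M X)"
  shows "hilbert_space_on (future_space M X) (future_inner M X \<Lambda>)
    \<longleftrightarrow> finite_dim (future_space M X)"
proof -
  define V where "V = future_space M X"
  define B where "B = future_dist M X ` \<Lambda>"
  have B: "countable B" "independent B" "span B = V"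
    using assms(2) by (simp_all add: B_def V_def hamel_basis_family_def)
  interpret inner_product_subspace V "future_inner M X \<Lambda>"
    using inner_product_future_inner[OF assms] subspace_span[of B]
    by unfold_locales (simp_all add: B(3) flip: V_def)
  have "hilbert_space_on V (future_inner M X \<Lambda>) \<longleftrightarrow> mcomplete"
    using subspace inner_product by (simp add: hilbert_space_on_def)
  also have "\<dots> \<longleftrightarrow> finite B"
    by (rule mcomplete_iff_finite[OF B])
  \<comment> \<open>Any finite basis makes the space complete, and completeness makes \<open>B\<close> finite.\<close>
  also have "\<dots> \<longleftrightarrow> finite_dim V"
    using B mcomplete_iff_finite[OF countable_finite] mcomplete_iff_finite[OF B]
    unfolding finite_dim_def by blast
  finally show ?thesis unfolding V_def .
qed

end
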